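(* Let $\alpha>0$, $\beta\ge0$, and suppose that $S:U\to Y$ satisfies the two assumptions stated in the context. For each $\gamma>0$ let $u_\gamma\in U$ be a global minimizer of $$\min_{u\in L^2(\Omega)}\ \mathcal{F}(u)+\mathcal{G}(u)+\tfrac\gamma2\|u\|_{L^2(\Omega)}^2 .$$ Then the family $\{u_\gamma\}_{\gamma>0}$ contains at least one subsequence $\{u_{\gamma_n}\}_{n\in\mathbb{N}}$, with $\gamma_n\to0$, converging weakly in $L^2(\Omega)$ as $n\to\infty$ to a global minimizer of $$\min_{u\in L^2(\Omega)}\ \mathcal{F}(u)+\mathcal{G}(u).$$ Furthermore, for any such subsequence the convergence is strong in $L^2(\Omega)$.
   Context: $\Omega\subset\mathbb{R}^N$ is a bounded domain, $d\ge 2$, and $u_1<u_2<\dots<u_d$ are given real numbers. The admissible set is $U=\{u\in L^2(\Omega): u(x)\in[u_1,u_d]\text{ for almost all }x\in\Omega\}$. $Y$ is a Hilbert space, $z\in Y$ is given, $S:U\to Y$ is a (generally nonlinear) mapping, and $\mathcal{F}(u)=\tfrac12\|S(u)-z\|_Y^2$. Assumptions on $S$: (i) $S$ is weak-to-weak continuous, i.e. if $\{u_n\}_{n\in\mathbb{N}}\subset U$ and $u_n\rightharpoonup u\in U$ weakly in $L^2(\Omega)$, then $S(u_n)\rightharpoonup S(u)$ weakly in $Y$; (ii) $S$ is twice Fréchet differentiable on $U$ (differentiability understood relative to $U$, i.e. with expansions for $u\to\bar u$, $u\in U$, and derivatives bounded linear on $L^2(\Omega)$). For $\alpha>0$, $\beta\ge0$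 define $\mathcal{G}_0:L^2(\Omega)\to\mathbb{R}\cup\{+\infty\}$ by $$\mathcal{G}_0(u)=\tfrac\alpha2\|u\|_{L^2(\Omega)}^2+\beta\int_\Omega\prod_{i=1}^d|u(x)-u_i|^0\,dx+\delta_U(u),$$ where $|0|^0=0$, $|t|^0=1$ for $t\ne0$, and $\delta_U(u)=0$ if $u\in U$, $\delta_U(u)=+\infty$ otherwise. $\mathcal{G}_0^*(q)=\sup_{u\in L^2(\Omega)}\langle q,u\rangle-\mathcal{G}_0(u)$ is the Fenchel conjugate on $L^2(\Omega)$, and $\mathcal{G}:=\mathcal{G}_0^{**}$ is the biconjugate, which equals $+\infty$ outside $U$ (so that $\mathcal{F}+\mathcal{G}$ is $+\infty$ outside $U$). *)

theory Defs
  imports "HOL-Analysis.Analysis"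
begin

text \<open>
  Elements of \<open>L\<^sup>2(\<Omega>)\<close> are represented by square-integrable functions on \<open>\<Omega>\<close> (the values
  outside \<open>\<Omega>\<close> are irrelevant); two functions represent the same element iff they agree almost
  everywhere on \<open>\<Omega>\<close>.  Inner product, norm, weak convergence and bounded operators below only
  depend on the represented elements.
\<close>

definition L2 :: "'a::euclidean_space set \<Rightarrow> ('a \<Rightarrow> real) set" where
  "L2 \<Omega> = {f \<in> borel_measurable (lebesgue_on \<Omega>). integrable (lebesgue_on \<Omega>) (\<lambda>x. (f x)\<^sup>2)}"

definition L2_inner :: "'a::euclidean_space set \<Rightarrow> ('a \<Rightarrow> real) \<Rightarrow> ('a \<Rightarrow> real) \<Rightarrow> real" where
  "L2_inner \<Omega> f g = (LINT x|lebesgue_on \<Omega>. f x * g x)"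

definition L2_norm :: "'a::euclidean_space set \<Rightarrow> ('a \<Rightarrow> real) \<Rightarrow> real" where
  "L2_norm \<Omega> f = sqrt (L2_inner \<Omega> f f)"

definition L2_dist :: "'a::euclidean_space set \<Rightarrow> ('a \<Rightarrow> real) \<Rightarrow> ('a \<Rightarrow> real) \<Rightarrow> real" where
  "L2_dist \<Omega> f g = L2_norm \<Omega> (\<lambda>x. f x - g x)"

definition L2_weakly_tendsto ::
    "'a::euclidean_space set \<Rightarrow> (nat \<Rightarrow> 'a \<Rightarrow> real) \<Rightarrow> ('a \<Rightarrow> real) \<Rightarrow> bool" where
  "L2_weakly_tendsto \<Omega> f g \<longleftrightarrow>
     (\<forall>n. f n \<in> L2 \<Omega>) \<and> g \<in> L2 \<Omega> \<and>
     (\<forall>\<phi>\<in>L2 \<Omega>. (\<lambda>n. L2_inner \<Omega> \<phi> (f n)) \<longlonglongrightarrow> L2_inner \<Omega> \<phi> g)"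

definition L2_strongly_tendsto ::
    "'a::euclidean_space set \<Rightarrow> (nat \<Rightarrow> 'a \<Rightarrow> real) \<Rightarrow> ('a \<Rightarrow> real) \<Rightarrow> bool" where
  "L2_strongly_tendsto \<Omega> f g \<longleftrightarrow>
     (\<forall>n. f n \<in> L2 \<Omega>) \<and> g \<in> L2 \<Omega> \<and> (\<lambda>n. L2_dist \<Omega> (f n) g) \<longlonglongrightarrow> 0"

definition weakly_tendsto :: "(nat \<Rightarrow> 'y::real_inner) \<Rightarrow> 'y \<Rightarrow> bool" where
  "weakly_tendsto y l \<longleftrightarrow> (\<forall>v. (\<lambda>n. v \<bullet> y n) \<longlonglongrightarrow> v \<bullet> l)"

definition L2_linear ::
    "'a::euclidean_space set \<Rightarrow> (('a \<Rightarrow> real) \<Rightarrow> 'y::real_vector) \<Rightarrow> bool" where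
  "L2_linear \<Omega> T \<longleftrightarrow>
     (\<forall>f\<in>L2 \<Omega>. \<forall>g\<in>L2 \<Omega>. \<forall>a b. T (\<lambda>x. a * f x + b * g x) = a *\<^sub>R T f + b *\<^sub>R T g)"

definition L2_bounded_linear ::
    "'a::euclidean_space set \<Rightarrow> (('a \<Rightarrow> real) \<Rightarrow> 'y::real_normed_vector) \<Rightarrow> bool" where
  "L2_bounded_linear \<Omega> T \<longleftrightarrow>
     L2_linear \<Omega> T \<and> (\<exists>K. \<forall>f\<in>L2 \<Omega>. norm (T f) \<le> K * L2_norm \<Omega> f)"

text \<open>The operator norm of a bounded linear map from \<open>L\<^sup>2(\<Omega>)\<close> to \<open>Y\<close>.\<close>

definition L2_onorm ::
    "'a::euclidean_space set \<Rightarrow> (('a \<Rightarrow> real) \<Rightarrow> 'y::real_normed_vector) \<Rightarrow> real" where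
  "L2_onorm \<Omega> T = (SUP f\<in>{f \<in> L2 \<Omega>. L2_norm \<Omega> f \<le> 1}. norm (T f))"

text \<open>
  \<open>S' u\<close> is the Frechet derivative of \<open>S\<close> at every \<open>u \<in> U\<close>, relative to \<open>U\<close>.
\<close>

definition L2_frechet_derivative_on ::
    "'a::euclidean_space set \<Rightarrow> ('a \<Rightarrow> real) set \<Rightarrow> (('a \<Rightarrow> real) \<Rightarrow> 'y::real_normed_vector)
      \<Rightarrow> (('a \<Rightarrow> real) \<Rightarrow> ('a \<Rightarrow> real) \<Rightarrow> 'y) \<Rightarrow> bool" where
  "L2_frechet_derivative_on \<Omega> U S S' \<longleftrightarrow>
     (\<forall>v\<in>U. L2_bounded_linear \<Omega> (S' v) \<and>
       (\<forall>\<epsilon>>0. \<exists>\<delta>>0. \<forall>u\<in>U. L2_dist \<Omega> u v < \<delta> \<longrightarrow>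
          norm (S u - S v - S' v (\<lambda>x. u x - v x)) \<le> \<epsilon> * L2_dist \<Omega> u v))"

text \<open>
  The same for a map \<open>A\<close> from \<open>U\<close> into the space \<open>\<L>(L\<^sup>2(\<Omega>), Y)\<close> of bounded linear maps,
  normed by the operator norm; \<open>A' v\<close> is a bounded linear map from \<open>L\<^sup>2(\<Omega>)\<close> into that space.
\<close>

definition L2_operator_frechet_derivative_on ::
    "'a::euclidean_space set \<Rightarrow> ('a \<Rightarrow> real) set
      \<Rightarrow> (('a \<Rightarrow> real) \<Rightarrow> ('a \<Rightarrow> real) \<Rightarrow> 'y::real_normed_vector)
      \<Rightarrow> (('a \<Rightarrow> real) \<Rightarrow> ('a \<Rightarrow> real) \<Rightarrow> ('a \<Rightarrow> real) \<Rightarrow> 'y) \<Rightarrow> bool" where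
  "L2_operator_frechet_derivative_on \<Omega> U A A' \<longleftrightarrow>
     (\<forall>v\<in>U.
       (\<forall>h\<in>L2 \<Omega>. L2_bounded_linear \<Omega> (A' v h)) \<and>
       (\<forall>k\<in>L2 \<Omega>. L2_linear \<Omega> (\<lambda>h. A' v h k)) \<and>
       (\<exists>K. \<forall>h\<in>L2 \<Omega>. L2_onorm \<Omega> (A' v h) \<le> K * L2_norm \<Omega> h) \<and>
       (\<forall>\<epsilon>>0. \<exists>\<delta>>0. \<forall>u\<in>U. L2_dist \<Omega> u v < \<delta> \<longrightarrow>
          L2_onorm \<Omega> (\<lambda>k. A u k - A v k - A' v (\<lambda>x. u x - v x) k) \<le> \<epsilon> * L2_dist \<Omega> u v))"

definition twice_frechet_differentiable_on ::
    "'a::euclidean_space set \<Rightarrow> ('a \<Rightarrow> real) set \<Rightarrow> (('a \<Rightarrow> real) \<Rightarrow> 'y::real_normed_vector) \<Rightarrow> bool"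
  where
  "twice_frechet_differentiable_on \<Omega> U S \<longleftrightarrow>
     (\<exists>S' S''. L2_frechet_derivative_on \<Omega> U S S' \<and> L2_operator_frechet_derivative_on \<Omega> U S' S'')"

definition weak_to_weak_continuous_on ::
    "'a::euclidean_space set \<Rightarrow> ('a \<Rightarrow> real) set \<Rightarrow> (('a \<Rightarrow> real) \<Rightarrow> 'y::real_inner) \<Rightarrow> bool" where
  "weak_to_weak_continuous_on \<Omega> U S \<longleftrightarrow>
     (\<forall>f u. (\<forall>n. f n \<in> U) \<longrightarrow> u \<in> U \<longrightarrow> L2_weakly_tendsto \<Omega> f u \<longrightarrow>
        weakly_tendsto (\<lambda>n. S (f n)) (S u))"

text \<open>\<open>S\<close> is well defined on the classes (modulo equality almost everywhere) of elements of \<open>U\<close>.\<close>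

definition respects_AE_on ::
    "'a::euclidean_space set \<Rightarrow> ('a \<Rightarrow> real) set \<Rightarrow> (('a \<Rightarrow> real) \<Rightarrow> 'y) \<Rightarrow> bool" where
  "respects_AE_on \<Omega> U S \<longleftrightarrow>
     (\<forall>u\<in>U. \<forall>v\<in>U. (AE x in lebesgue_on \<Omega>. u x = v x) \<longrightarrow> S u = S v)"

text \<open>The given numbers are \<open>a 1 < \<dots> < a d\<close>.\<close>

definition admissible :: "'a::euclidean_space set \<Rightarrow> nat \<Rightarrow> (nat \<Rightarrow> real) \<Rightarrow> ('a \<Rightarrow> real) set" where
  "admissible \<Omega> d a = {u \<in> L2 \<Omega>. AE x in lebesgue_on \<Omega>. u x \<in> {a 1..a d}}"

text \<open>\<open>|t|\<^sup>0\<close> with the convention \<open>|0|\<^sup>0 = 0\<close>, unlike \<open>0 ^ 0 = 1\<close> in the library.\<close>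

definition abs_pow0 :: "real \<Rightarrow> real" where
  "abs_pow0 t = (if t = 0 then 0 else 1)"

definition delta :: "'b set \<Rightarrow> 'b \<Rightarrow> ereal" where
  "delta U u = (if u \<in> U then 0 else \<infinity>)"

definition G0 ::
    "'a::euclidean_space set \<Rightarrow> nat \<Rightarrow> (nat \<Rightarrow> real) \<Rightarrow> real \<Rightarrow> real \<Rightarrow> ('a \<Rightarrow> real) \<Rightarrow> ereal" where
  "G0 \<Omega> d a \<alpha> \<beta> u =
     ereal (\<alpha> / 2 * (L2_norm \<Omega> u)\<^sup>2
            + \<beta> * (LINT x|lebesgue_on \<Omega>. (\<Prod>i=1..d. abs_pow0 (u x - a i))))
     + delta (admissible \<Omega> d a) u"

text \<open>Fenchel conjugate on \<open>L\<^sup>2(\<Omega>)\<close>, identified with its dual.\<close>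

definition fenchel_conjugate ::
    "'a::euclidean_space set \<Rightarrow> (('a \<Rightarrow> real) \<Rightarrow> ereal) \<Rightarrow> ('a \<Rightarrow> real) \<Rightarrow> ereal" where
  "fenchel_conjugate \<Omega> J q = (SUP u\<in>L2 \<Omega>. ereal (L2_inner \<Omega> q u) - J u)"

definition G ::
    "'a::euclidean_space set \<Rightarrow> nat \<Rightarrow> (nat \<Rightarrow> real) \<Rightarrow> real \<Rightarrow> real \<Rightarrow> ('a \<Rightarrow> real) \<Rightarrow> ereal" where
  "G \<Omega> d a \<alpha> \<beta> = fenchel_conjugate \<Omega> (fenchel_conjugate \<Omega> (G0 \<Omega> d a \<alpha> \<beta>))"

definition tracking :: "(('a \<Rightarrow> real) \<Rightarrow> 'y::real_normed_vector) \<Rightarrow> 'y \<Rightarrow> ('a \<Rightarrow> real) \<Rightarrow> real" where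
  "tracking S z u = 1 / 2 * (norm (S u - z))\<^sup>2"

text \<open>
  \<open>S\<close> is a total function in HOL, but its values outside \<open>U\<close> play no role:
  there \<open>G\<close>, hence the objective, is \<open>\<infinity>\<close>.
\<close>

definition objective ::
    "'a::euclidean_space set \<Rightarrow> nat \<Rightarrow> (nat \<Rightarrow> real) \<Rightarrow> real \<Rightarrow> real
      \<Rightarrow> (('a \<Rightarrow> real) \<Rightarrow> 'y::real_normed_vector) \<Rightarrow> 'y \<Rightarrow> ('a \<Rightarrow> real) \<Rightarrow> ereal" where
  "objective \<Omega> d a \<alpha> \<beta> S z u = ereal (tracking S z u) + G \<Omega> d a \<alpha> \<beta> u"

definition L2_global_minimizer ::
    "'a::euclidean_space set \<Rightarrow> (('a \<Rightarrow> real) \<Rightarrow> ereal) \<Rightarrow> ('a \<Rightarrow> real) \<Rightarrow> bool" where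
  "L2_global_minimizer \<Omega> J u \<longleftrightarrow> is_arg_min J (\<lambda>v. v \<in> L2 \<Omega>) u"

end

theory Submission
  imports Defs "HOL-Library.Diagonal_Subsequence"
begin

text \<open>
  Throughout, \<open>J\<close> is the unregularized objective \<open>\<F> + \<G>\<close>, and \<open>u\<^sub>\<gamma>\<close> minimizes
  \<open>J + \<gamma>/2 \<parallel>\<cdot>\<parallel>\<^sup>2\<close>.

  The existence of a subsequence is the direct method.  The admissible set is weakly sequentially
  compact (lemma \<open>admissible_weakly_sequentially_compact\<close>), so along some \<open>\<gamma>\<^sub>n \<rightarrow> 0\<close> the minimizers
  converge weakly to an admissible \<open>w\<close>.  Both summands of \<open>J\<close> are weakly lower semicontinuous: a
  Fenchel conjugate is a supremum of weakly continuous affine functions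
  (\<open>fenchel_conjugate_weakly_lsc\<close>), and the tracking term lies above its tangent at \<open>S w\<close>, which
  is weakly continuous in \<open>S u\<close>.  Letting \<open>n \<rightarrow> \<infinity>\<close> in
  \<open>J u\<^sub>\<gamma> \<le> J v + \<gamma>/2 \<parallel>v\<parallel>\<^sup>2\<close> gives \<open>J w \<le> J v\<close> for every \<open>v\<close>
  (\<open>weak_limit_of_regularized_minimizers\<close>).

  Strong convergence comes from comparing \<open>u\<^sub>\<gamma>\<close> with any minimizer \<open>w\<close> of \<open>J\<close>: each of the two is
  optimal for its own problem, and subtracting the finite value \<open>J u\<^sub>\<gamma>\<close> leaves \<open>\<parallel>u\<^sub>\<gamma>\<parallel> \<le> \<parallel>w\<parallel>\<close>
  (\<open>regularized_minimizer_norm_le\<close>).  A weakly convergent sequence whose norms do not exceed the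
  norm of the limit converges strongly.

  The weak compactness rests on the uniform boundedness of the admissible functions.  Lebesgue measure on \<open>\<Omega>\<close> is separable: countably many sets approximate every measurable set.  A
  diagonal subsequence makes the integrals over these countably many sets converge, the uniform
  bound extends this to all measurable sets, and the Radon-Nikodym theorem turns the limiting set
  function into the weak limit.  Convergence against indicators then passes to all integrable test
  functions by density.
\<close>

section \<open>Convergent subsequences and uniform approximation\<close>

lemma bounded_family_common_convergent_subseq:
  fixes X :: "nat \<Rightarrow> 'i \<Rightarrow> real"
  assumes "countable I" and bnd: "\<And>i n. i \<in> I \<Longrightarrow> \<bar>X n i\<bar> \<le> K i"
  obtains r :: "nat \<Rightarrow> nat" where "strict_mono r" "\<And>i. i \<in> I \<Longrightarrow> convergent (\<lambda>n. X (r n) i)"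
proof (cases "I = {}")
  case True
  show ?thesis
    by (rule that[of id]) (use True in \<open>auto simp: strict_mono_def\<close>)
next
  case False
  define e where "e = from_nat_into I"
  have e: "e k \<in> I" for k
    using False by (simp add: e_def from_nat_into)
  interpret subseqs "\<lambda>k s. convergent (\<lambda>n. X (s n) (e k))"
  proof
    fix k and s :: "nat \<Rightarrow> nat"
    assume "strict_mono s"
    have "bounded (range (\<lambda>n. X (s n) (e k)))"
      using bnd[OF e[of k]] by (auto simp: bounded_iff)
    from bounded_imp_convergent_subsequence[OF this]
    obtain l r where "strict_mono r" "((\<lambda>n. X (s n) (e k)) \<circ> r) \<longlonglongrightarrow> l"
      by metis
    then show "\<exists>r'. strict_mono r' \<and> convergent (\<lambda>n. X ((s \<circ> r') n) (e k))"
      by (auto simp: convergent_def o_def)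
  qed
  have "convergent (\<lambda>n. X ((diagseq \<circ> (+) (Suc k)) n) (e k))" for k
  proof (rule diagseq_holds)
    fix r s :: "nat \<Rightarrow> nat" and k
    assume "strict_mono r" "convergent (\<lambda>n. X (s n) (e k))"
    from convergent_subseq_convergent[OF this(2,1)]
    show "convergent (\<lambda>n. X ((s \<circ> r) n) (e k))"
      by (simp add: o_def)
  qed
  then have "convergent (\<lambda>n. X (diagseq (n + Suc k)) (e k))" for k
    by (simp only: o_def add.commute[of _ "Suc k"])
  then have conv: "convergent (\<lambda>n. X (diagseq n) (e k))" for k
    using convergent_ignore_initial_segment[of "\<lambda>n. X (diagseq n) (e k)" "Suc k"] by blast
  show ?thesis
  proof (rule that[OF subseq_diagseq])
    fix i assume "i \<in> I"
    then have "i = e (to_nat_on I i)"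
      by (simp add: e_def assms(1))
    then show "convergent (\<lambda>n. X (diagseq n) i)"
      using conv by metis
  qed
qed

text \<open>
  The next two lemmas carry convergence of the integrals from a dense class of test functions to
  all of them.  The first is used when the limit is known, the second to produce a limit.
\<close>

lemma uniformly_approximable_tendsto:
  fixes X :: "nat \<Rightarrow> real"
  assumes "\<And>e. e > 0 \<Longrightarrow> \<exists>Y y. Y \<longlonglongrightarrow> y \<and> (\<forall>n. \<bar>X n - Y n\<bar> \<le> e) \<and> \<bar>x - y\<bar> \<le> e"
  shows "X \<longlonglongrightarrow> x"
proof (rule LIMSEQ_I)
  fix e :: real assume "e > 0"
  then obtain Y y where Y: "Y \<longlonglongrightarrow> y" "\<And>n. \<bar>X n - Y n\<bar> \<le> e/4" "\<bar>x - y\<bar> \<le> e/4"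
    using assms[of "e/4"] by auto
  from LIMSEQ_D[OF Y(1), of "e/4"] \<open>e > 0\<close> obtain N where N: "\<And>n. n \<ge> N \<Longrightarrow> \<bar>Y n - y\<bar> < e/4"
    by auto
  show "\<exists>N. \<forall>n\<ge>N. norm (X n - x) < e"
  proof (intro exI allI impI)
    fix n assume "n \<ge> N"
    from N[OF this] Y(2)[of n] Y(3) \<open>e > 0\<close> show "norm (X n - x) < e"
      by (simp add: abs_if split: if_splits)
  qed
qed

lemma uniformly_approximable_convergent:
  fixes X :: "nat \<Rightarrow> real"
  assumes "\<And>e. e > 0 \<Longrightarrow> \<exists>Y. convergent Y \<and> (\<forall>n. \<bar>X n - Y n\<bar> \<le> e)"
  shows "convergent X"
proof (rule Cauchy_convergent, rule metric_CauchyI)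
  fix e :: real assume "e > 0"
  then obtain Y where Y: "convergent Y" "\<And>n. \<bar>X n - Y n\<bar> \<le> e/4"
    using assms[of "e/4"] by auto
  from metric_CauchyD[OF convergent_Cauchy[OF Y(1)], of "e/4"] \<open>e > 0\<close>
  obtain N where N: "\<And>m n. m \<ge> N \<Longrightarrow> n \<ge> N \<Longrightarrow> dist (Y m) (Y n) < e/4"
    by auto
  show "\<exists>N. \<forall>m\<ge>N. \<forall>n\<ge>N. dist (X m) (X n) < e"
  proof (intro exI allI impI)
    fix m n assume "m \<ge> N" "n \<ge> N"
    from N[OF this] Y(2)[of n] Y(2)[of m] \<open>e > 0\<close> show "dist (X m) (X n) < e"
      by (simp add: dist_real_def abs_if split: if_splits)
  qed
qed

section \<open>Weak compactness of uniformly bounded functions on a separable measure space\<close>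

text \<open>
  The bounds by multiples of the measure do two jobs.  They upgrade finite to countable additivity,
  because \<open>\<nu> = L - c \<mu>\<close> lies between \<open>0\<close> and \<open>(d - c) \<mu>\<close> and so is continuous from above at the
  empty set; and they confine all averages of the Radon-Nikodym density, hence the density itself,
  to \<open>[c, d]\<close>.
\<close>

lemma (in finite_measure) bounded_additive_set_function_density:
  fixes L :: "'a set \<Rightarrow> real"
  assumes add: "\<And>A B. A \<in> sets M \<Longrightarrow> B \<in> sets M \<Longrightarrow> A \<inter> B = {} \<Longrightarrow> L (A \<union> B) = L A + L B"
    and lower: "\<And>A. A \<in> sets M \<Longrightarrow> c * measure M A \<le> L A"
    and upper: "\<And>A. A \<in> sets M \<Longrightarrow> L A \<le> d * measure M A"
  obtains w :: "'a \<Rightarrow> real" where "w \<in> borel_measurable M" "AE x in M. w x \<in> {c..d}"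
    "\<And>A. A \<in> sets M \<Longrightarrow> (LINT x|M. indicator A x * w x) = L A"
proof -
  define \<nu> where "\<nu> A = L A - c * measure M A" for A
  have \<nu>_nonneg: "0 \<le> \<nu> A" and \<nu>_le: "\<nu> A \<le> (d - c) * measure M A" if "A \<in> sets M" for A
    using lower[OF that] upper[OF that] by (auto simp: \<nu>_def algebra_simps)
  have \<nu>_add: "\<nu> (A \<union> B) = \<nu> A + \<nu> B" if "A \<in> sets M" "B \<in> sets M" "A \<inter> B = {}" for A B
    using add[OF that] finite_measure_Union[OF that] by (simp add: \<nu>_def algebra_simps)
  have \<nu>_empty: "\<nu> {} = 0"
    using \<nu>_nonneg[of "{}"] \<nu>_le[of "{}"] by simp
  define N where "N = measure_of (space M) (sets M) (\<lambda>A. ennreal (\<nu> A))"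
  have sets_N: "sets N = sets M" and space_N: "space N = space M"
    by (simp_all add: N_def)
  have pos: "positive (sets M) (\<lambda>A. ennreal (\<nu> A))"
    by (simp add: positive_def \<nu>_empty)
  have "countably_additive (sets M) (\<lambda>A. ennreal (\<nu> A))"
  proof (rule sets.empty_continuous_imp_countably_additive[OF pos])
    show "additive (sets M) (\<lambda>A. ennreal (\<nu> A))"
      by (auto simp: additive_def \<nu>_add \<nu>_nonneg)
    fix A :: "nat \<Rightarrow> 'a set"
    assume A: "range A \<subseteq> sets M" "decseq A" "(\<Inter>i. A i) = {}"
    have "(\<lambda>i. (d - c) * measure M (A i)) \<longlonglongrightarrow> (d - c) * 0"
      using finite_Lim_measure_decseq[OF A(1,2)] A(3) by (intro tendsto_intros) simp
    then have "(\<lambda>i. \<nu> (A i)) \<longlonglongrightarrow> 0"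
      using A(1) \<nu>_nonneg \<nu>_le
      by (intro tendsto_sandwich[OF _ _ tendsto_const,
            where g="\<lambda>i. \<nu> (A i)" and h="\<lambda>i. (d - c) * measure M (A i)"])
         (auto simp: range_subsetD)
    then show "(\<lambda>i. ennreal (\<nu> (A i))) \<longlonglongrightarrow> 0"
      using tendsto_ennrealI by fastforce
  qed auto
  then have em_N: "emeasure N A = ennreal (\<nu> A)" if "A \<in> sets M" for A
    using that pos by (simp add: N_def emeasure_measure_of_sigma sets.sigma_algebra_axioms)
  have "finite_measure N"
    by (rule finite_measureI) (simp add: space_N em_N)
  have ac: "absolutely_continuous M N"
  proof (unfold absolutely_continuous_def, rule subsetI)
    fix A assume "A \<in> null_sets M"
    then have "A \<in> sets M" "measure M A = 0"
      by (auto simp: measure_eq_0_null_sets)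
    then show "A \<in> null_sets N"
      using \<nu>_nonneg[of A] \<nu>_le[of A] by (intro null_setsI) (auto simp: em_N sets_N)
  qed
  from real_RN_deriv[OF \<open>finite_measure N\<close> ac sets_N]
  obtain D where D: "D \<in> borel_measurable M" "AE x in M. RN_deriv M N x = ennreal (D x)" "\<And>x. 0 \<le> D x"
    by metis
  note D(1)[measurable]
  have nn: "(\<integral>\<^sup>+x. ennreal (indicator A x * D x) \<partial>M) = ennreal (\<nu> A)" if A[measurable]: "A \<in> sets M" for A
  proof -
    have "(\<integral>\<^sup>+x. ennreal (indicator A x * D x) \<partial>M) = (\<integral>\<^sup>+x. RN_deriv M N x * indicator A x \<partial>M)"
      using D(2) by (intro nn_integral_cong_AE) (auto split: split_indicator)
    also have "\<dots> = emeasure (density M (RN_deriv M N)) A"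
      by (simp add: emeasure_density)
    also have "\<dots> = ennreal (\<nu> A)"
      by (simp add: density_RN_deriv[OF ac sets_N] em_N)
    finally show ?thesis .
  qed
  have int_ind: "integrable M (\<lambda>x. indicator A x * D x)"
    and LINT_ind: "(LINT x|M. indicator A x * D x) = \<nu> A" if [measurable]: "A \<in> sets M" for A
    using nn[OF that] \<nu>_nonneg[OF that] D(3)
     by (auto intro!: integrableI_nonneg simp: integral_eq_nn_integral)
  have intD: "integrable M D"
    using int_ind[of "space M"] by (rule Bochner_Integration.integrable_cong[THEN iffD1, rotated -1]) auto
  define w where "w x = D x + c" for x
  have w[measurable]: "w \<in> borel_measurable M" "integrable M w"
    using intD by (simp_all add: w_def[abs_def])
  have L_eq: "(LINT x|M. indicator A x * w x) = L A" if [measurable]: "A \<in> sets M" for A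
  proof -
    have "(LINT x|M. indicator A x * w x) = (LINT x|M. indicator A x * D x + c * indicator A x)"
      by (intro Bochner_Integration.integral_cong) (auto simp: w_def algebra_simps)
    also have "\<dots> = \<nu> A + c * measure M A"
      using int_ind[OF that] by (subst Bochner_Integration.integral_add) (auto simp: LINT_ind Int_absorb2 sets.sets_into_space less_top[symmetric])
    finally show ?thesis
      by (simp add: \<nu>_def)
  qed
  have "AE x in M. w x \<in> {c..d}"
  proof (rule averaging_theorem[OF w(2)])
    fix A assume "A \<in> sets M" "0 < measure M A"
    moreover from this(1) have "set_lebesgue_integral M A w = L A"
      by (simp add: set_lebesgue_integral_def L_eq)
    ultimately show "(1 / measure M A) *\<^sub>R set_lebesgue_integral M A w \<in> {c..d}"
      using lower[of A] upper[of A] by (simp add: field_simps)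
  qed auto
  with w(1) L_eq show ?thesis
    using that by blast
qed

lemma integrable_mult_AE_bounded:
  fixes f \<phi> :: "'a \<Rightarrow> real"
  assumes \<phi>: "integrable M \<phi>" and f: "f \<in> borel_measurable M" "AE x in M. \<bar>f x\<bar> \<le> K"
  shows "integrable M (\<lambda>x. \<phi> x * f x)"
proof (rule Bochner_Integration.integrable_bound)
  show "integrable M (\<lambda>x. K * \<phi> x)"
    using \<phi> by simp
  show "(\<lambda>x. \<phi> x * f x) \<in> borel_measurable M"
    using borel_measurable_integrable[OF \<phi>] f(1) by simp
  show "AE x in M. norm (\<phi> x * f x) \<le> norm (K * \<phi> x)"
    using f(2)
  proof eventually_elim
    case (elim x)
    then have "\<bar>\<phi> x\<bar> * \<bar>f x\<bar> \<le> \<bar>\<phi> x\<bar> * \<bar>K\<bar>"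
      by (intro mult_left_mono) auto
    then show ?case
      by (simp add: abs_mult mult.commute)
  qed
qed

lemma integral_mult_diff_bound:
  fixes f \<phi> \<psi> :: "'a \<Rightarrow> real"
  assumes [measurable]: "f \<in> borel_measurable M" and bnd: "AE x in M. \<bar>f x\<bar> \<le> K"
    and \<phi>: "integrable M \<phi>" and \<psi>: "integrable M \<psi>"
  shows "\<bar>(LINT x|M. \<phi> x * f x) - (LINT x|M. \<psi> x * f x)\<bar> \<le> K * (LINT x|M. \<bar>\<phi> x - \<psi> x\<bar>)"
proof -
  note [measurable] = borel_measurable_integrable[OF \<phi>] borel_measurable_integrable[OF \<psi>]
  have int: "integrable M (\<lambda>x. \<theta> x * f x)" if "integrable M \<theta>" for \<theta>
    using that assms(1,2) by (rule integrable_mult_AE_bounded)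
  have "(LINT x|M. \<phi> x * f x) - (LINT x|M. \<psi> x * f x) = (LINT x|M. (\<phi> x - \<psi> x) * f x)"
    using int[OF \<phi>] int[OF \<psi>] by (simp add: left_diff_distrib)
  also have "\<bar>\<dots>\<bar> \<le> (LINT x|M. \<bar>(\<phi> x - \<psi> x) * f x\<bar>)"
    by (rule integral_abs_bound)
  also have "\<dots> \<le> (LINT x|M. K * \<bar>\<phi> x - \<psi> x\<bar>)"
  proof (rule integral_mono_AE)
    show "integrable M (\<lambda>x. \<bar>(\<phi> x - \<psi> x) * f x\<bar>)"
      using int[of "\<lambda>x. \<phi> x - \<psi> x"] \<phi> \<psi> by simp
    show "AE x in M. \<bar>(\<phi> x - \<psi> x) * f x\<bar> \<le> K * \<bar>\<phi> x - \<psi> x\<bar>"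
      using bnd by eventually_elim (simp add: abs_mult mult_left_mono mult.commute[of K])
  qed (use \<phi> \<psi> in auto)
  finally show ?thesis by simp
qed

text \<open>
  The bound \<open>K\<close> makes the functionals \<open>\<phi> \<mapsto> \<integral> \<phi> f\<^sub>n\<close> equicontinuous in the \<open>L\<^sup>1\<close> norm, so the
  class of test functions on which they converge is closed under dominated limits.
\<close>

lemma (in finite_measure) integral_convergence_from_sets:
  fixes f :: "nat \<Rightarrow> 'a \<Rightarrow> real"
  assumes f: "\<And>n. f n \<in> borel_measurable M" "\<And>n. AE x in M. \<bar>f n x\<bar> \<le> K"
    and w: "w \<in> borel_measurable M" "AE x in M. \<bar>w x\<bar> \<le> K"
    and sets_lim: "\<And>A. A \<in> sets M \<Longrightarrow>
      (\<lambda>n. LINT x|M. indicator A x * f n x) \<longlonglongrightarrow> (LINT x|M. indicator A x * w x)"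
    and "integrable M \<phi>"
  shows "(\<lambda>n. LINT x|M. \<phi> x * f n x) \<longlonglongrightarrow> (LINT x|M. \<phi> x * w x)"
  using \<open>integrable M \<phi>\<close>
proof (induction rule: integrable_induct)
  case (base A c)
  have "(\<lambda>n. c * (LINT x|M. indicator A x * f n x)) \<longlonglongrightarrow> c * (LINT x|M. indicator A x * w x)"
    by (intro tendsto_intros sets_lim base)
  then show ?case
    by (simp add: mult.assoc mult.left_commute[of _ c])
next
  case (add \<phi> \<psi>)
  show ?case
    using tendsto_add[OF add(3,4)] add(1,2)
    by (simp add: distrib_right integrable_mult_AE_bounded[OF _ f] integrable_mult_AE_bounded[OF _ w])
next
  case (lim \<phi> s)
  show ?case
  proof (rule uniformly_approximable_tendsto)
    fix e :: real assume "e > 0"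
    \<comment> \<open>The factor 3 arises from \<open>\<bar>s i x\<bar> \<le> 2 * \<bar>\<phi> x\<bar>\<close>.\<close>
    have "(\<lambda>i. LINT x|M. \<bar>\<phi> x - s i x\<bar>) \<longlonglongrightarrow> (LINT x|M. 0)"
    proof (rule integral_dominated_convergence[where w="\<lambda>x. 3 * \<bar>\<phi> x\<bar>"])
      show "AE x in M. (\<lambda>i. \<bar>\<phi> x - s i x\<bar>) \<longlonglongrightarrow> 0"
      proof (rule AE_I2)
        fix x assume "x \<in> space M"
        then have "(\<lambda>i. \<bar>\<phi> x - s i x\<bar>) \<longlonglongrightarrow> \<bar>\<phi> x - \<phi> x\<bar>"
          by (intro tendsto_intros lim)
        then show "(\<lambda>i. \<bar>\<phi> x - s i x\<bar>) \<longlonglongrightarrow> 0" by simp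
      qed
      show "AE x in M. norm \<bar>\<phi> x - s i x\<bar> \<le> 3 * \<bar>\<phi> x\<bar>" for i
      proof (rule AE_I2)
        fix x assume "x \<in> space M"
        from lim(3)[OF this, of i] show "norm \<bar>\<phi> x - s i x\<bar> \<le> 3 * \<bar>\<phi> x\<bar>"
          by simp
      qed
    qed (use lim in auto)
    then have "(\<lambda>i. K * (LINT x|M. \<bar>\<phi> x - s i x\<bar>)) \<longlonglongrightarrow> K * 0"
      by (intro tendsto_intros) simp
    from order_tendstoD(2)[OF this, of e] \<open>e > 0\<close>
    obtain i where i: "K * (LINT x|M. \<bar>\<phi> x - s i x\<bar>) < e"
      by (auto simp: eventually_sequentially)
    have "\<bar>(LINT x|M. \<phi> x * f n x) - (LINT x|M. s i x * f n x)\<bar> \<le> e" for n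
      using integral_mult_diff_bound[OF f lim(4) lim(1), of n i] i by linarith
    moreover have "\<bar>(LINT x|M. \<phi> x * w x) - (LINT x|M. s i x * w x)\<bar> \<le> e"
      using integral_mult_diff_bound[OF w lim(4) lim(1), of i] i by linarith
    ultimately show "\<exists>Y y. Y \<longlonglongrightarrow> y \<and>
        (\<forall>n. \<bar>(LINT x|M. \<phi> x * f n x) - Y n\<bar> \<le> e) \<and> \<bar>(LINT x|M. \<phi> x * w x) - y\<bar> \<le> e"
      using lim(5)[of i] by blast
  qed
qed

text \<open>
  Separability of the measure algebra for the pseudometric \<open>\<mu> (A \<triangle> B)\<close>.
\<close>

definition countably_approximable_sets :: "'a measure \<Rightarrow> bool" where
  "countably_approximable_sets M \<longleftrightarrow>
     (\<exists>E. countable E \<and> E \<subseteq> sets M \<and>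
        (\<forall>A\<in>sets M. \<forall>e>0. \<exists>B\<in>E. measure M (sym_diff A B) < e))"

text \<open>
  Integrals over nearby sets differ little, uniformly in \<open>n\<close>.  Hence convergence on the countable
  family \<open>E\<close>, obtained by a diagonal argument, spreads to all measurable sets; the limit is an
  additive set function pinched between \<open>c \<mu>\<close> and \<open>d \<mu>\<close>, so it has a density \<open>w\<close>.
\<close>

lemma (in finite_measure) weak_sequential_compactness_AE_bounded:
  fixes f :: "nat \<Rightarrow> 'a \<Rightarrow> real"
  assumes sep: "countably_approximable_sets M"
    and f: "\<And>n. f n \<in> borel_measurable M" "\<And>n. AE x in M. f n x \<in> {c..d}"
  obtains r w where "strict_mono (r :: nat \<Rightarrow> nat)" "w \<in> borel_measurable M" "AE x in M. w x \<in> {c..d}"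
    "\<And>\<phi>. integrable M \<phi> \<Longrightarrow> (\<lambda>n. LINT x|M. \<phi> x * f (r n) x) \<longlonglongrightarrow> (LINT x|M. \<phi> x * w x)"
proof -
  from sep obtain E where E: "countable E" "E \<subseteq> sets M"
    "\<And>A e. A \<in> sets M \<Longrightarrow> e > 0 \<Longrightarrow> \<exists>B\<in>E. measure M (sym_diff A B) < e"
    by (auto simp: countably_approximable_sets_def)
  define K where "K = \<bar>c\<bar> + \<bar>d\<bar>"
  have "K \<ge> 0"
    by (simp add: K_def)
  have f_bnd: "AE x in M. \<bar>f n x\<bar> \<le> K" for n
    using f(2)[of n] by eventually_elim (auto simp: K_def)
  define I where "I n A = (LINT x|M. indicator A x * f n x)" for n A
  have int_ind: "integrable M (indicator A :: _ \<Rightarrow> real)" if "A \<in> sets M" for A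
    using that by (simp add: less_top[symmetric])
  have int: "integrable M (f n)" for n
    by (rule integrable_const_bound[of _ K]) (use f f_bnd in auto)
  have int': "integrable M (\<lambda>x. indicator A x * f n x)" if "A \<in> sets M" for A n
    using integrable_mult_indicator[OF that int] by simp
  have I_diff: "\<bar>I n A - I n B\<bar> \<le> K * measure M (sym_diff A B)"
    if [measurable]: "A \<in> sets M" "B \<in> sets M" for n A B
  proof -
    have "\<bar>I n A - I n B\<bar> \<le> K * (LINT x|M. \<bar>indicator A x - indicator B x\<bar>)"
      unfolding I_def using that by (intro integral_mult_diff_bound f f_bnd int_ind)
    also have "(LINT x|M. \<bar>indicator A x - indicator B x :: real\<bar>) = (LINT x|M. indicator (sym_diff A B) x)"
      by (intro Bochner_Integration.integral_cong) (auto split: split_indicator)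
    also have "\<dots> = measure M (sym_diff A B)"
    proof -
      have "sym_diff A B \<in> sets M"
        using that by auto
      then have "sym_diff A B \<inter> space M = sym_diff A B"
        by (intro Int_absorb2 sets.sets_into_space)
      then show ?thesis
        by (simp only: Bochner_Integration.integral_indicator)
    qed
    finally show ?thesis .
  qed
  have I_bnd: "\<bar>I n B\<bar> \<le> K * measure M B" if "B \<in> E" for n B
    using I_diff[of B "{}" n] subsetD[OF E(2) that] by (simp add: I_def)
  obtain r :: "nat \<Rightarrow> nat" where r: "strict_mono r" "\<And>B. B \<in> E \<Longrightarrow> convergent (\<lambda>n. I (r n) B)"
    using bounded_family_common_convergent_subseq[OF E(1), of I "\<lambda>B. K * measure M B"] I_bnd
    by metis
  have conv: "convergent (\<lambda>n. I (r n) A)" if A: "A \<in> sets M" for A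
  proof (rule uniformly_approximable_convergent)
    fix e :: real assume "e > 0"
    \<comment> \<open>Dividing by \<open>K + 1\<close> avoids a case split on \<open>K = 0\<close>.\<close>
    with \<open>K \<ge> 0\<close> have "e / (K + 1) > 0" by simp
    from E(3)[OF A this] obtain B where B: "B \<in> E" "measure M (sym_diff A B) < e / (K + 1)"
      by blast
    have "K * measure M (sym_diff A B) \<le> (K + 1) * measure M (sym_diff A B)"
      by (intro mult_right_mono) auto
    also have "\<dots> \<le> e"
      using B(2) \<open>K \<ge> 0\<close> by (simp add: field_simps)
    finally have "K * measure M (sym_diff A B) \<le> e" .
    moreover have "B \<in> sets M"
      using B(1) E(2) by blast
    ultimately have "\<bar>I (r n) A - I (r n) B\<bar> \<le> e" for n
      using I_diff[OF A, of B "r n"] by linarith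
    with r(2)[OF B(1)] show "\<exists>Y. convergent Y \<and> (\<forall>n. \<bar>I (r n) A - Y n\<bar> \<le> e)"
      by (intro exI[of _ "\<lambda>n. I (r n) B"]) simp
  qed
  define L where "L A = lim (\<lambda>n. I (r n) A)" for A
  have L: "(\<lambda>n. I (r n) A) \<longlonglongrightarrow> L A" if "A \<in> sets M" for A
    using conv[OF that] by (simp add: L_def convergent_LIMSEQ_iff)
  have I_bounds: "c * measure M A \<le> I n A" "I n A \<le> d * measure M A" if A: "A \<in> sets M" for n A
  proof -
    have eq: "(LINT x|M. indicator A x * t) = t * measure M A" for t :: real
      using A by (simp add: Int_absorb2 sets.sets_into_space)
    have "(LINT x|M. indicator A x * c) \<le> I n A"
      unfolding I_def
    proof (intro integral_mono_AE int' A)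
      show "AE x in M. indicator A x * c \<le> indicator A x * f n x"
        using f(2)[of n] by eventually_elim (auto split: split_indicator)
    qed (use int_ind[OF A] in auto)
    then show "c * measure M A \<le> I n A" by (simp only: eq)
    have "I n A \<le> (LINT x|M. indicator A x * d)"
      unfolding I_def
    proof (intro integral_mono_AE int' A)
      show "AE x in M. indicator A x * f n x \<le> indicator A x * d"
        using f(2)[of n] by eventually_elim (auto split: split_indicator)
    qed (use int_ind[OF A] in auto)
    then show "I n A \<le> d * measure M A" by (simp only: eq)
  qed
  have L_add: "L (A \<union> B) = L A + L B" if AB: "A \<in> sets M" "B \<in> sets M" "A \<inter> B = {}" for A B
  proof -
    have "I n (A \<union> B) = I n A + I n B" for n
    proof -
      have "I n (A \<union> B) = (LINT x|M. indicator A x * f n x + indicator B x * f n x)"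
        unfolding I_def using AB(3)
        by (intro Bochner_Integration.integral_cong) (auto split: split_indicator)
      also have "\<dots> = I n A + I n B"
        unfolding I_def by (rule Bochner_Integration.integral_add[OF int'[OF AB(1)] int'[OF AB(2)]])
      finally show ?thesis .
    qed
    then have "(\<lambda>n. I (r n) (A \<union> B)) \<longlonglongrightarrow> L A + L B"
      using tendsto_add[OF L[OF AB(1)] L[OF AB(2)]] by simp
    from LIMSEQ_unique[OF L[of "A \<union> B"] this] AB(1,2) show ?thesis
      by simp
  qed
  have L_bounds: "c * measure M A \<le> L A" "L A \<le> d * measure M A" if A: "A \<in> sets M" for A
    using I_bounds[OF A]
    by (blast intro: LIMSEQ_le_const[OF L[OF A]] LIMSEQ_le_const2[OF L[OF A]])+
  obtain w where w: "w \<in> borel_measurable M" "AE x in M. w x \<in> {c..d}"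
    "\<And>A. A \<in> sets M \<Longrightarrow> (LINT x|M. indicator A x * w x) = L A"
  proof (rule bounded_additive_set_function_density[of L c d])
    fix w :: "'a \<Rightarrow> real"
    assume "w \<in> borel_measurable M" "AE x in M. w x \<in> {c..d}"
      "\<And>A. A \<in> sets M \<Longrightarrow> (LINT x|M. indicator A x * w x) = L A"
    then show ?thesis by (rule that)
  qed (rule L_add L_bounds; assumption)+
  have w_bnd: "AE x in M. \<bar>w x\<bar> \<le> K"
    using w(2) by eventually_elim (auto simp: K_def)
  show ?thesis
  proof (rule that[OF r(1) w(1,2)])
    fix \<phi> :: "'a \<Rightarrow> real" assume "integrable M \<phi>"
    show "(\<lambda>n. LINT x|M. \<phi> x * f (r n) x) \<longlonglongrightarrow> (LINT x|M. \<phi> x * w x)"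
      by (rule integral_convergence_from_sets[OF f(1) f_bnd w(1) w_bnd _ \<open>integrable M \<phi>\<close>])
         (use L w(3) in \<open>simp add: I_def\<close>)
  qed
qed

text \<open>
  Outer regularity replaces a measurable set by an open one, and continuity of the measure from
  below replaces that by a finite union of members of a countable base.
\<close>

lemma countably_approximable_sets_lebesgue_on:
  fixes \<Omega> :: "'a::euclidean_space set"
  assumes \<Omega>: "\<Omega> \<in> lmeasurable"
  shows "countably_approximable_sets (lebesgue_on \<Omega>)"
proof -
  obtain D :: "'a set set" where D: "countable D" "topological_basis D"
    using ex_countable_basis by blast
  define E where "E = (\<lambda>F. \<Union>F \<inter> \<Omega>) ` {F. finite F \<and> F \<subseteq> D}"
  interpret finite_measure "lebesgue_on \<Omega>"
    by (rule finite_measure_lebesgue_on[OF \<Omega>])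
  have \<Omega>': "\<Omega> \<in> sets lebesgue"
    using \<Omega> by (rule fmeasurableD)
  have open_sets: "T \<inter> \<Omega> \<in> sets (lebesgue_on \<Omega>)" if "open T" for T
    using that by (auto simp: sets_restrict_space)
  have "countable E"
    unfolding E_def by (intro countable_image countable_Collect_finite_subset D)
  moreover have "E \<subseteq> sets (lebesgue_on \<Omega>)"
    using topological_basis_open[OF D(2)] by (auto simp: E_def intro!: open_sets open_Union)
  moreover have "\<exists>B\<in>E. measure (lebesgue_on \<Omega>) (sym_diff A B) < e"
    if A: "A \<in> sets (lebesgue_on \<Omega>)" and "e > 0" for A e
  proof -
    have A_leb: "A \<in> sets lebesgue" and "A \<subseteq> \<Omega>"
      using A \<Omega>' by (auto simp: sets_restrict_space_iff sets_restrict_space)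
    from \<open>e > 0\<close> have "e/2 > 0" by simp
    from sets_lebesgue_outer_open[OF A_leb this] obtain T where
      T: "open T" "A \<subseteq> T" "T - A \<in> lmeasurable" "emeasure lebesgue (T - A) < ennreal (e/2)"
      by blast
    obtain D' where D': "D' \<subseteq> D" "\<Union>D' = T"
      using D(2) T(1) by (auto simp: topological_basis_def)
    have "countable D'"
      using D(1) D'(1) countable_subset by blast
    \<comment> \<open>\<open>from_nat_into\<close> enumerates only nonempty sets, so an empty \<open>D'\<close> has its own branch.\<close>
    define U where "U k = \<Union>(if D' = {} then {} else from_nat_into D' ` {..k}) \<inter> \<Omega>" for k :: nat
    have UE: "U k \<in> E" for k
      unfolding U_def E_def using D'(1) from_nat_into[of D'] by (intro imageI) auto
    have U_un: "(\<Union>k. U k) = T \<inter> \<Omega>"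
    proof (cases "D' = {}")
      case False
      then have "range (from_nat_into D') = D'"
        using \<open>countable D'\<close> by (rule range_from_nat_into)
      moreover have "(\<Union>k. \<Union>(from_nat_into D' ` {..k})) = \<Union>(range (from_nat_into D'))"
        by auto
      moreover have "(\<Union>k. U k) = (\<Union>k. \<Union>(from_nat_into D' ` {..k})) \<inter> \<Omega>"
        unfolding U_def if_not_P[OF False] by (rule UN_extend_simps(4)[symmetric])
      ultimately show ?thesis
        by (simp only: D'(2))
    qed (use D'(2) in \<open>auto simp: U_def\<close>)
    have U_sets: "U k \<in> sets (lebesgue_on \<Omega>)" for k
      using UE \<open>E \<subseteq> sets (lebesgue_on \<Omega>)\<close> by blast
    have U_sub: "U k \<subseteq> T \<inter> \<Omega>" for k
      using U_un by blast
    have "(\<lambda>k. measure (lebesgue_on \<Omega>) (U k)) \<longlonglongrightarrow> measure (lebesgue_on \<Omega>) (\<Union>k. U k)"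
      using U_sets by (intro finite_Lim_measure_incseq) (auto simp: U_def incseq_def)
    from order_tendstoD(1)[OF this, of "measure (lebesgue_on \<Omega>) (T \<inter> \<Omega>) - e/2"] \<open>e > 0\<close>
    obtain k where k: "measure (lebesgue_on \<Omega>) (T \<inter> \<Omega>) - e/2 < measure (lebesgue_on \<Omega>) (U k)"
      by (auto simp: U_un eventually_sequentially)
    have TA: "T \<inter> \<Omega> - A \<in> sets (lebesgue_on \<Omega>)" and TU: "T \<inter> \<Omega> - U k \<in> sets (lebesgue_on \<Omega>)"
      using open_sets[OF T(1)] A U_sets by auto
    have "emeasure (lebesgue_on \<Omega>) (T \<inter> \<Omega> - A) = emeasure lebesgue (T \<inter> \<Omega> - A)"
      using \<Omega>' by (intro emeasure_restrict_space) auto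
    also have "\<dots> \<le> emeasure lebesgue (T - A)"
      using T(3) by (intro emeasure_mono fmeasurableD) auto
    also have "\<dots> < ennreal (e/2)"
      by (rule T)
    finally have 1: "measure (lebesgue_on \<Omega>) (T \<inter> \<Omega> - A) < e/2"
      by (simp only: emeasure_eq_measure ennreal_less_iff[OF measure_nonneg])
    have 2: "measure (lebesgue_on \<Omega>) (T \<inter> \<Omega> - U k) < e/2"
      using finite_measure_Diff[OF open_sets[OF T(1)] U_sets U_sub] k by simp
    have "measure (lebesgue_on \<Omega>) (sym_diff A (U k))
        \<le> measure (lebesgue_on \<Omega>) ((T \<inter> \<Omega> - A) \<union> (T \<inter> \<Omega> - U k))"
      using TA TU U_sub[of k] T(2) \<open>A \<subseteq> \<Omega>\<close> by (intro finite_measure_mono) auto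
    also have "\<dots> \<le> measure (lebesgue_on \<Omega>) (T \<inter> \<Omega> - A) + measure (lebesgue_on \<Omega>) (T \<inter> \<Omega> - U k)"
      using TA TU by (rule measure_Un_le)
    finally show ?thesis
      using 1 2 UE[of k] by (intro bexI[of _ "U k"]) auto
  qed
  ultimately show ?thesis
    unfolding countably_approximable_sets_def by blast
qed

section \<open>The space \<open>L\<^sup>2\<close>\<close>

lemma L2_imp_integrable:
  assumes \<Omega>: "\<Omega> \<in> lmeasurable" and f: "f \<in> L2 \<Omega>"
  shows "integrable (lebesgue_on \<Omega>) f"
proof -
  interpret finite_measure "lebesgue_on \<Omega>"
    by (rule finite_measure_lebesgue_on[OF \<Omega>])
  show ?thesis
  proof (rule Bochner_Integration.integrable_bound)
    show "integrable (lebesgue_on \<Omega>) (\<lambda>x. 1 + (f x)\<^sup>2)"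
      using f by (auto simp: L2_def)
    have "\<bar>t\<bar> \<le> 1 + t\<^sup>2" for t :: real
    proof -
      have "0 \<le> (\<bar>t\<bar> - 1/2)\<^sup>2" by simp
      then have "\<bar>t\<bar> \<le> 1/4 + t\<^sup>2" by (simp add: power2_diff power_divide)
      then show ?thesis by linarith
    qed
    then show "AE x in lebesgue_on \<Omega>. norm (f x) \<le> norm (1 + (f x)\<^sup>2)"
      by (intro AE_I2) simp
  qed (use f in \<open>auto simp: L2_def\<close>)
qed

lemma admissible_weakly_sequentially_compact:
  assumes \<Omega>: "\<Omega> \<in> lmeasurable" and f: "\<And>n. f n \<in> admissible \<Omega> d a"
  obtains r w where "strict_mono (r :: nat \<Rightarrow> nat)" "w \<in> admissible \<Omega> d a"
    "L2_weakly_tendsto \<Omega> (\<lambda>n. f (r n)) w"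
proof -
  interpret finite_measure "lebesgue_on \<Omega>"
    by (rule finite_measure_lebesgue_on[OF \<Omega>])
  have f': "f n \<in> L2 \<Omega>" "AE x in lebesgue_on \<Omega>. f n x \<in> {a 1..a d}" for n
    using f[of n] by (simp_all add: admissible_def)
  obtain r w where r: "strict_mono (r :: nat \<Rightarrow> nat)" and w: "w \<in> borel_measurable (lebesgue_on \<Omega>)"
    "AE x in lebesgue_on \<Omega>. w x \<in> {a 1..a d}"
    and lim: "\<And>\<phi>. integrable (lebesgue_on \<Omega>) \<phi> \<Longrightarrow>
      (\<lambda>n. LINT x|lebesgue_on \<Omega>. \<phi> x * f (r n) x) \<longlonglongrightarrow> (LINT x|lebesgue_on \<Omega>. \<phi> x * w x)"
    by (rule weak_sequential_compactness_AE_bounded[OF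
          countably_approximable_sets_lebesgue_on[OF \<Omega>], of f "a 1" "a d"])
       (use f' in \<open>auto simp: L2_def\<close>)
  have "integrable (lebesgue_on \<Omega>) (\<lambda>x. (w x)\<^sup>2)"
  proof (rule integrable_const_bound)
    show "AE x in lebesgue_on \<Omega>. norm ((w x)\<^sup>2) \<le> (\<bar>a 1\<bar> + \<bar>a d\<bar>)\<^sup>2"
      using w(2)
    proof eventually_elim
      case (elim x)
      then have "\<bar>w x\<bar> \<le> \<bar>\<bar>a 1\<bar> + \<bar>a d\<bar>\<bar>"
        by simp linarith
      then show ?case
        by (simp only: abs_le_square_iff real_norm_def abs_power2)
    qed
  qed (use w in auto)
  then have "w \<in> L2 \<Omega>"
    using w(1) by (simp add: L2_def)
  moreover from this w(2) have "w \<in> admissible \<Omega> d a"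
    by (simp add: admissible_def)
  ultimately show ?thesis
    using r lim[OF L2_imp_integrable[OF \<Omega>]] f'(1)
    by (intro that[of r w]) (simp_all add: L2_weakly_tendsto_def L2_inner_def)
qed

lemma L2_integrable_mult:
  assumes "f \<in> L2 \<Omega>" "g \<in> L2 \<Omega>"
  shows "integrable (lebesgue_on \<Omega>) (\<lambda>x. f x * g x)"
proof (rule Bochner_Integration.integrable_bound)
  show "integrable (lebesgue_on \<Omega>) (\<lambda>x. (f x)\<^sup>2 + (g x)\<^sup>2)"
    using assms by (auto simp: L2_def)
  have "\<bar>s * t\<bar> \<le> s\<^sup>2 + t\<^sup>2" for s t :: real
  proof -
    have "2 * (\<bar>s\<bar> * \<bar>t\<bar>) \<le> s\<^sup>2 + t\<^sup>2"
      using sum_squares_bound[of "\<bar>s\<bar>" "\<bar>t\<bar>"] by (simp add: mult.assoc)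
    moreover have "0 \<le> \<bar>s\<bar> * \<bar>t\<bar>"
      by simp
    ultimately show ?thesis
      unfolding abs_mult by linarith
  qed
  then show "AE x in lebesgue_on \<Omega>. norm (f x * g x) \<le> norm ((f x)\<^sup>2 + (g x)\<^sup>2)"
    by (intro AE_I2) simp
qed (use assms in \<open>auto simp: L2_def\<close>)

lemma L2_norm_squared: "(L2_norm \<Omega> f)\<^sup>2 = L2_inner \<Omega> f f"
  by (simp add: L2_norm_def L2_inner_def)

lemma L2_inner_commute: "L2_inner \<Omega> f g = L2_inner \<Omega> g f"
  by (simp add: L2_inner_def mult.commute)

lemma L2_dist_squared:
  assumes "f \<in> L2 \<Omega>" "g \<in> L2 \<Omega>"
  shows "(L2_dist \<Omega> f g)\<^sup>2 = (L2_norm \<Omega> f)\<^sup>2 - 2 * L2_inner \<Omega> g f + (L2_norm \<Omega> g)\<^sup>2"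
proof -
  have "(L2_dist \<Omega> f g)\<^sup>2 = (LINT x|lebesgue_on \<Omega>. f x * f x - 2 * (g x * f x) + g x * g x)"
    unfolding L2_dist_def L2_norm_squared L2_inner_def
    by (intro Bochner_Integration.integral_cong) (auto simp: algebra_simps)
  also have "\<dots> = (LINT x|lebesgue_on \<Omega>. f x * f x) - 2 * (LINT x|lebesgue_on \<Omega>. g x * f x)
      + (LINT x|lebesgue_on \<Omega>. g x * g x)"
    using L2_integrable_mult[OF assms(1,1)] L2_integrable_mult[OF assms(2,1)]
      L2_integrable_mult[OF assms(2,2)]
    by (simp add: Bochner_Integration.integral_add Bochner_Integration.integral_diff)
  finally show ?thesis
    by (simp add: L2_norm_squared L2_inner_def)
qed

lemma L2_norm_nonneg: "0 \<le> L2_norm \<Omega> f"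
  by (simp add: L2_norm_def L2_inner_def)

text \<open>
  Expanding the square, \<open>\<parallel>f\<^sub>n - g\<parallel>\<^sup>2 \<le> 2 \<parallel>g\<parallel>\<^sup>2 - 2 \<langle>g, f\<^sub>n\<rangle>\<close>, and the right-hand side tends to
  \<open>0\<close> by weak convergence.
\<close>

lemma L2_weakly_tendsto_norm_le_imp_strongly:
  assumes weak: "L2_weakly_tendsto \<Omega> f g" and norm_le: "\<And>n. L2_norm \<Omega> (f n) \<le> L2_norm \<Omega> g"
  shows "L2_strongly_tendsto \<Omega> f g"
proof -
  have f: "f n \<in> L2 \<Omega>" and g: "g \<in> L2 \<Omega>" for n
    using weak by (auto simp: L2_weakly_tendsto_def)
  have "(\<lambda>n. 2 * (L2_norm \<Omega> g)\<^sup>2 - 2 * L2_inner \<Omega> g (f n))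
      \<longlonglongrightarrow> 2 * (L2_norm \<Omega> g)\<^sup>2 - 2 * L2_inner \<Omega> g g"
    using weak g by (intro tendsto_intros) (auto simp: L2_weakly_tendsto_def)
  then have lim: "(\<lambda>n. 2 * (L2_norm \<Omega> g)\<^sup>2 - 2 * L2_inner \<Omega> g (f n)) \<longlonglongrightarrow> 0"
    by (simp add: L2_norm_squared)
  have "(L2_dist \<Omega> (f n) g)\<^sup>2 \<le> 2 * (L2_norm \<Omega> g)\<^sup>2 - 2 * L2_inner \<Omega> g (f n)" for n
    using L2_dist_squared[OF f g, of n] power_mono[OF norm_le[of n] L2_norm_nonneg, of 2] by simp
  then have "(\<lambda>n. (L2_dist \<Omega> (f n) g)\<^sup>2) \<longlonglongrightarrow> 0"
    by (intro tendsto_sandwich[OF _ _ tendsto_const lim]) auto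
  from tendsto_real_sqrt[OF this] have "(\<lambda>n. L2_dist \<Omega> (f n) g) \<longlonglongrightarrow> 0"
    by (simp add: L2_dist_def L2_norm_nonneg)
  with f g show ?thesis
    by (simp add: L2_strongly_tendsto_def)
qed

section \<open>Fenchel conjugates and the functional \<open>\<G>\<close>\<close>

lemma fenchel_biconjugate_le:
  assumes "u \<in> L2 \<Omega>"
  shows "fenchel_conjugate \<Omega> (fenchel_conjugate \<Omega> J) u \<le> J u"
proof -
  have "ereal (L2_inner \<Omega> u q) - fenchel_conjugate \<Omega> J q \<le> J u" for q
  proof -
    have "ereal (L2_inner \<Omega> q u) - J u \<le> fenchel_conjugate \<Omega> J q"
      unfolding fenchel_conjugate_def using assms by (rule SUP_upper)
    then show ?thesis
      by (cases "J u"; cases "fenchel_conjugate \<Omega> J q")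
         (auto simp: L2_inner_commute[of \<Omega> u q])
  qed
  then show ?thesis
    by (subst fenchel_conjugate_def) (rule SUP_least)
qed

text \<open>
  The dual point \<open>0\<close> suffices: the biconjugate is at least \<open>- J\<^sup>* 0 = inf J\<close>.
\<close>

lemma fenchel_biconjugate_nonneg:
  assumes "\<And>v. v \<in> L2 \<Omega> \<Longrightarrow> 0 \<le> J v"
  shows "0 \<le> fenchel_conjugate \<Omega> (fenchel_conjugate \<Omega> J) u"
proof -
  have zero: "(\<lambda>x. 0) \<in> L2 \<Omega>"
    by (simp add: L2_def)
  have "fenchel_conjugate \<Omega> J (\<lambda>x. 0) \<le> 0"
    unfolding fenchel_conjugate_def
  proof (rule SUP_least)
    fix v assume "v \<in> L2 \<Omega>"
    from assms[OF this] show "ereal (L2_inner \<Omega> (\<lambda>x. 0) v) - J v \<le> 0"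
      by (cases "J v") (auto simp: L2_inner_def zero_ereal_def)
  qed
  then have "0 \<le> ereal (L2_inner \<Omega> u (\<lambda>x. 0)) - fenchel_conjugate \<Omega> J (\<lambda>x. 0)"
    by (cases "fenchel_conjugate \<Omega> J (\<lambda>x. 0)") (auto simp: L2_inner_def zero_ereal_def)
  also have "\<dots> \<le> fenchel_conjugate \<Omega> (fenchel_conjugate \<Omega> J) u"
    by (subst (2) fenchel_conjugate_def) (rule SUP_upper[OF zero])
  finally show ?thesis .
qed

text \<open>
  Weak lower semicontinuity in a form that avoids \<open>liminf\<close>: an upper bound along the sequence by a
  convergent real sequence passes to the limit, since it does so for each affine function in the
  supremum.  An infinite \<open>J q\<close> makes the affine function constant, equal to \<open>-\<infinity>\<close> or \<open>\<infinity>\<close>.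
\<close>

lemma fenchel_conjugate_weakly_lsc:
  assumes weak: "L2_weakly_tendsto \<Omega> f w" and t: "t \<longlonglongrightarrow> l"
    and le: "\<And>n. fenchel_conjugate \<Omega> J (f n) \<le> ereal (t n)"
  shows "fenchel_conjugate \<Omega> J w \<le> ereal l"
  unfolding fenchel_conjugate_def
proof (rule SUP_least)
  fix q assume q: "q \<in> L2 \<Omega>"
  have "ereal (L2_inner \<Omega> (f n) q) - J q \<le> fenchel_conjugate \<Omega> J (f n)" for n
    unfolding fenchel_conjugate_def using q by (rule SUP_upper)
  from order_trans[OF this le]
  have *: "ereal (L2_inner \<Omega> q (f n)) - J q \<le> ereal (t n)" for n
    by (simp add: L2_inner_commute)
  show "ereal (L2_inner \<Omega> w q) - J q \<le> ereal l"
  proof (cases "J q")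
    case (real c)
    have "(\<lambda>n. L2_inner \<Omega> q (f n) - c) \<longlonglongrightarrow> L2_inner \<Omega> q w - c"
      using weak q by (intro tendsto_intros) (auto simp: L2_weakly_tendsto_def)
    from LIMSEQ_le[OF this t] * real have "L2_inner \<Omega> q w - c \<le> l"
      by auto
    then show ?thesis
      by (simp add: real L2_inner_commute)
  qed (use *[of 0] in auto)
qed

lemma G_nonneg:
  assumes "\<alpha> \<ge> 0" "\<beta> \<ge> 0"
  shows "0 \<le> G \<Omega> d a \<alpha> \<beta> u"
proof -
  have "0 \<le> (LINT x|lebesgue_on \<Omega>. (\<Prod>i=1..d. abs_pow0 (v x - a i)))" for v
    by (intro integral_nonneg_AE AE_I2 prod_nonneg) (simp add: abs_pow0_def)
  then have "0 \<le> G0 \<Omega> d a \<alpha> \<beta> v" for v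
    using assms unfolding G0_def
    by (intro add_nonneg_nonneg) (auto simp: delta_def)
  then show ?thesis
    unfolding G_def by (rule fenchel_biconjugate_nonneg)
qed

lemma G_finite_on_admissible:
  assumes "u \<in> admissible \<Omega> d a"
  shows "G \<Omega> d a \<alpha> \<beta> u < \<infinity>"
proof -
  have "G \<Omega> d a \<alpha> \<beta> u \<le> G0 \<Omega> d a \<alpha> \<beta> u"
    unfolding G_def using assms by (intro fenchel_biconjugate_le) (simp add: admissible_def)
  also have "\<dots> < \<infinity>"
    using assms by (simp add: G0_def delta_def)
  finally show ?thesis .
qed

section \<open>Minimizers of the regularized problems\<close>

text \<open>
  Convexity of the squared norm in the value of \<open>S\<close>; \<open>S\<close> itself may be nonlinear.  The left-hand
  side is continuous along weak convergence of \<open>S v\<close>, whereas the right-hand side need not be.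
\<close>

lemma tracking_ge_tangent:
  fixes S :: "('a \<Rightarrow> real) \<Rightarrow> 'y::real_inner"
  shows "tracking S z w + (S w - z) \<bullet> (S v - S w) \<le> tracking S z v"
proof -
  have "S v - z = (S w - z) + (S v - S w)"
    by simp
  then have "(norm (S v - z))\<^sup>2 = (norm (S w - z))\<^sup>2 + 2 * ((S w - z) \<bullet> (S v - S w)) + (norm (S v - S w))\<^sup>2"
    by (metis power2_norm_eq_inner inner_add_left inner_add_right inner_commute
        add.assoc mult_2)
  then show ?thesis
    by (simp add: tracking_def)
qed

text \<open>
  For a competitor \<open>v\<close> with finite objective \<open>j\<close>, minimality of \<open>f n\<close> and the tangent bound for the
  tracking term bound \<open>G (f n)\<close> by a real sequence \<open>t n\<close> with limit \<open>j - tracking S z w\<close>, and lower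
  semicontinuity of \<open>G\<close> finishes the argument.
\<close>

lemma weak_limit_of_regularized_minimizers:
  fixes S :: "('a::euclidean_space \<Rightarrow> real) \<Rightarrow> 'y::real_inner"
  assumes \<alpha>\<beta>: "\<alpha> \<ge> 0" "\<beta> \<ge> 0" and S: "weak_to_weak_continuous_on \<Omega> (admissible \<Omega> d a) S"
    and f: "\<And>n. f n \<in> admissible \<Omega> d a" and w: "w \<in> admissible \<Omega> d a"
    and weak: "L2_weakly_tendsto \<Omega> f w" and \<gamma>: "\<And>n. \<gamma> n \<ge> 0" "\<gamma> \<longlonglongrightarrow> 0"
    and min: "\<And>n. L2_global_minimizer \<Omega>
      (\<lambda>v. objective \<Omega> d a \<alpha> \<beta> S z v + ereal (\<gamma> n / 2 * (L2_norm \<Omega> v)\<^sup>2)) (f n)"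
  shows "L2_global_minimizer \<Omega> (objective \<Omega> d a \<alpha> \<beta> S z) w"
proof -
  have "objective \<Omega> d a \<alpha> \<beta> S z w \<le> objective \<Omega> d a \<alpha> \<beta> S z v" if v: "v \<in> L2 \<Omega>" for v
  proof (cases "objective \<Omega> d a \<alpha> \<beta> S z v")
    case (real j)
    define t where "t n = j + \<gamma> n / 2 * (L2_norm \<Omega> v)\<^sup>2
      - (tracking S z w + ((S w - z) \<bullet> S (f n) - (S w - z) \<bullet> S w))" for n
    have "weakly_tendsto (\<lambda>n. S (f n)) (S w)"
      using S f w weak by (auto simp: weak_to_weak_continuous_on_def)
    then have "(\<lambda>n. (S w - z) \<bullet> S (f n)) \<longlonglongrightarrow> (S w - z) \<bullet> S w"
      by (simp add: weakly_tendsto_def)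
    then have "t \<longlonglongrightarrow> j + 0 / 2 * (L2_norm \<Omega> v)\<^sup>2
        - (tracking S z w + ((S w - z) \<bullet> S w - (S w - z) \<bullet> S w))"
      unfolding t_def by (intro tendsto_add tendsto_diff tendsto_mult tendsto_divide tendsto_const \<gamma>(2)) auto
    then have t: "t \<longlonglongrightarrow> j - tracking S z w"
      by simp
    have "G \<Omega> d a \<alpha> \<beta> (f n) \<le> ereal (t n)" for n
    proof -
      have "objective \<Omega> d a \<alpha> \<beta> S z (f n) + ereal (\<gamma> n / 2 * (L2_norm \<Omega> (f n))\<^sup>2)
          \<le> ereal (j + \<gamma> n / 2 * (L2_norm \<Omega> v)\<^sup>2)"
        using min[of n] v real by (auto simp: L2_global_minimizer_def is_arg_min_linorder)
      moreover have "0 \<le> \<gamma> n / 2 * (L2_norm \<Omega> (f n))\<^sup>2"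
        using \<gamma>(1)[of n] by simp
      ultimately show ?thesis
        using tracking_ge_tangent[of S z w "f n"]
        by (cases "G \<Omega> d a \<alpha> \<beta> (f n)") (auto simp: objective_def t_def inner_diff_right)
    qed
    then have "G \<Omega> d a \<alpha> \<beta> w \<le> ereal (j - tracking S z w)"
      unfolding G_def by (rule fenchel_conjugate_weakly_lsc[OF weak t])
    then have "objective \<Omega> d a \<alpha> \<beta> S z w \<le> ereal j"
      by (cases "G \<Omega> d a \<alpha> \<beta> w") (auto simp: objective_def)
    then show ?thesis
      by (simp only: real)
  next
    case MInf
    then show ?thesis
      using G_nonneg[OF \<alpha>\<beta>, of \<Omega> d a v]
      by (cases "G \<Omega> d a \<alpha> \<beta> v") (auto simp: objective_def)
  qed simp
  then show ?thesis
    using w by (auto simp: L2_global_minimizer_def is_arg_min_linorder admissible_def)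
qed

text \<open>
  Adding the two optimality inequalities, the values of the objective at \<open>u\<close> cancel.  This
  cancellation in the extended reals is legitimate because \<open>G\<close> is nonnegative, and finite at the
  admissible \<open>u\<close>.
\<close>

lemma regularized_minimizer_norm_le:
  assumes \<alpha>\<beta>: "\<alpha> \<ge> 0" "\<beta> \<ge> 0" and "\<gamma> > 0" and u: "u \<in> admissible \<Omega> d a"
    and min: "L2_global_minimizer \<Omega>
      (\<lambda>v. objective \<Omega> d a \<alpha> \<beta> S z v + ereal (\<gamma> / 2 * (L2_norm \<Omega> v)\<^sup>2)) u"
    and w: "L2_global_minimizer \<Omega> (objective \<Omega> d a \<alpha> \<beta> S z) w"
  shows "L2_norm \<Omega> u \<le> L2_norm \<Omega> w"
proof -
  have "objective \<Omega> d a \<alpha> \<beta> S z u + ereal (\<gamma> / 2 * (L2_norm \<Omega> u)\<^sup>2)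
      \<le> objective \<Omega> d a \<alpha> \<beta> S z w + ereal (\<gamma> / 2 * (L2_norm \<Omega> w)\<^sup>2)"
    using min w by (auto simp: L2_global_minimizer_def is_arg_min_linorder)
  also have "\<dots> \<le> objective \<Omega> d a \<alpha> \<beta> S z u + ereal (\<gamma> / 2 * (L2_norm \<Omega> w)\<^sup>2)"
    using u w by (intro add_right_mono)
      (auto simp: L2_global_minimizer_def is_arg_min_linorder admissible_def)
  finally have "\<gamma> / 2 * (L2_norm \<Omega> u)\<^sup>2 \<le> \<gamma> / 2 * (L2_norm \<Omega> w)\<^sup>2"
    using G_nonneg[OF \<alpha>\<beta>, of \<Omega> d a u] G_finite_on_admissible[OF u, of \<alpha> \<beta>]
    by (cases "G \<Omega> d a \<alpha> \<beta> u") (auto simp: objective_def)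
  with \<open>\<gamma> > 0\<close> show ?thesis
    using L2_norm_nonneg by (auto intro: power2_le_imp_le)
qed

theorem proposition4p1:
  fixes \<Omega> :: "(real ^ 'n) set"
    and d :: nat and a :: "nat \<Rightarrow> real"
    and \<alpha> \<beta> :: real
    and S :: "(real ^ 'n \<Rightarrow> real) \<Rightarrow> 'y::{real_inner, complete_space}"
    and z :: 'y
    and u :: "real \<Rightarrow> real ^ 'n \<Rightarrow> real"
  assumes "open \<Omega>" "connected \<Omega>" "\<Omega> \<noteq> {}" "bounded \<Omega>"
    and "d \<ge> 2" "strict_mono_on {1..d} a"
    and "\<alpha> > 0" "\<beta> \<ge> 0"
    and "respects_AE_on \<Omega> (admissible \<Omega> d a) S"
    and "weak_to_weak_continuous_on \<Omega> (admissible \<Omega> d a) S"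
    and "twice_frechet_differentiable_on \<Omega> (admissible \<Omega> d a) S"
    and "\<And>\<gamma>. \<gamma> > 0 \<Longrightarrow> u \<gamma> \<in> admissible \<Omega> d a"
    and "\<And>\<gamma>. \<gamma> > 0 \<Longrightarrow> L2_global_minimizer \<Omega>
           (\<lambda>v. objective \<Omega> d a \<alpha> \<beta> S z v + ereal (\<gamma> / 2 * (L2_norm \<Omega> v)\<^sup>2)) (u \<gamma>)"
  shows "(\<exists>\<gamma> w. (\<forall>n. \<gamma> n > 0) \<and> \<gamma> \<longlonglongrightarrow> 0 \<and>
             L2_global_minimizer \<Omega> (objective \<Omega> d a \<alpha> \<beta> S z) w \<and>
             L2_weakly_tendsto \<Omega> (\<lambda>n. u (\<gamma> n)) w)
       \<and> (\<forall>\<gamma> w. (\<forall>n. \<gamma> n > 0) \<and> \<gamma> \<longlonglongrightarrow> 0 \<and>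
             L2_global_minimizer \<Omega> (objective \<Omega> d a \<alpha> \<beta> S z) w \<and>
             L2_weakly_tendsto \<Omega> (\<lambda>n. u (\<gamma> n)) w
           \<longrightarrow> L2_strongly_tendsto \<Omega> (\<lambda>n. u (\<gamma> n)) w)"
proof (intro conjI allI impI)
  have \<Omega>: "\<Omega> \<in> lmeasurable"
    using assms(1,4) by (intro bounded_set_imp_lmeasurable) (auto simp: borel_open)
  define g :: "nat \<Rightarrow> real" where "g n = inverse (real (Suc n))" for n
  have g_pos: "g n > 0" for n
    by (simp add: g_def)
  have "u (g n) \<in> admissible \<Omega> d a" for n
    using assms(12) g_pos .
  then obtain r w where r: "strict_mono r" and w: "w \<in> admissible \<Omega> d a"
    and weak: "L2_weakly_tendsto \<Omega> (\<lambda>n. u (g (r n))) w"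
    by (rule admissible_weakly_sequentially_compact[OF \<Omega>, of "\<lambda>n. u (g n)"])
  have "g \<longlonglongrightarrow> 0"
    unfolding g_def by (rule LIMSEQ_inverse_real_of_nat)
  from LIMSEQ_subseq_LIMSEQ[OF this r] have lim: "(\<lambda>n. g (r n)) \<longlonglongrightarrow> 0"
    by (simp add: o_def)
  have "L2_global_minimizer \<Omega> (objective \<Omega> d a \<alpha> \<beta> S z) w"
    by (rule weak_limit_of_regularized_minimizers[OF less_imp_le[OF assms(7)] assms(8,10) _ w weak _ lim])
       (use assms(12,13) g_pos in \<open>auto intro: less_imp_le\<close>)
  with g_pos lim weak show "\<exists>\<gamma> w. (\<forall>n. \<gamma> n > 0) \<and> \<gamma> \<longlonglongrightarrow> 0 \<and>
      L2_global_minimizer \<Omega> (objective \<Omega> d a \<alpha> \<beta> S z) w \<and> L2_weakly_tendsto \<Omega> (\<lambda>n. u (\<gamma> n)) w"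
    by (intro exI[of _ "\<lambda>n. g (r n)"] exI[of _ w]) simp
next
  fix \<gamma> :: "nat \<Rightarrow> real" and w
  assume *: "(\<forall>n. \<gamma> n > 0) \<and> \<gamma> \<longlonglongrightarrow> 0 \<and>
    L2_global_minimizer \<Omega> (objective \<Omega> d a \<alpha> \<beta> S z) w \<and> L2_weakly_tendsto \<Omega> (\<lambda>n. u (\<gamma> n)) w"
  then have "L2_norm \<Omega> (u (\<gamma> n)) \<le> L2_norm \<Omega> w" for n
    using assms(12,13) by (intro regularized_minimizer_norm_le[OF less_imp_le[OF assms(7)] assms(8), where \<gamma>="\<gamma> n"]) auto
  with * show "L2_strongly_tendsto \<Omega> (\<lambda>n. u (\<gamma> n)) w"
    by (intro L2_weakly_tendsto_norm_le_imp_strongly) auto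
qed

end
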